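(* If the group $X$ is not isomorphic to $\mathbb Z$ and is linearly and Archimedean ordered, then $X^i$ is trivial, i.e. $X^i=\{\mathbf 1\}$.
   Context: $G$ is a nontrivial connected compact abelian group; $X$ is its (discrete) character group, written multiplicatively, with unit character $\mathbf 1$. $T\subset X$ is a fixed subsemigroup (positive cone) with $\mathbf 1\in T$, $T\cap T^{-1}=\{\mathbf 1\}$, $X=T^{-1}T$; it defines an order on $X$ by $\xi\le\chi$ iff $\chi\xi^{-1}\in T$. $X$ is linearly ordered means $T\cup T^{-1}=X$; the order is Archimedean if for all $\chi,\xi\in T\setminus\{\mathbf 1\}$ there is a natural number $n$ with $\xi^n\ge\chi$. $X^i$ is the set of characters having an index, i.e. the set of $\chi\in X$ of the form $\chi=\chi_1\chi_2^{-1}$ with $\chi_j\in T$ and both sets $T\setminus\chi_jT$ finite ($j=1,2$). *)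

theory Defs
  imports Complex_Main "HOL-Algebra.Elementary_Groups"
begin

text \<open>
  The group \<open>G\<close> is the additively written type \<open>'g\<close>; its characters are the continuous
  homomorphisms into the unit circle, with pointwise multiplication.
\<close>

definition character_group :: "('g::topological_ab_group_add \<Rightarrow> complex) monoid" where
  "character_group =
    \<lparr>carrier = {\<chi>. continuous_on UNIV \<chi> \<and> (\<forall>x. cmod (\<chi> x) = 1) \<and>
                    (\<forall>x y. \<chi> (x + y) = \<chi> x * \<chi> y)},
     monoid.mult = (\<lambda>\<chi> \<xi> x. \<chi> x * \<xi> x),
     one = (\<lambda>x. 1)\<rparr>"

definition positive_cone :: "('a, 'b) monoid_scheme \<Rightarrow> 'a set \<Rightarrow> bool" where
  "positive_cone X T \<longleftrightarrow>
     T \<subseteq> carrier X \<and>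
     (\<forall>\<chi>\<in>T. \<forall>\<xi>\<in>T. \<chi> \<otimes>\<^bsub>X\<^esub> \<xi> \<in> T) \<and>
     \<one>\<^bsub>X\<^esub> \<in> T \<and>
     T \<inter> set_inv\<^bsub>X\<^esub> T = {\<one>\<^bsub>X\<^esub>} \<and>
     carrier X = set_inv\<^bsub>X\<^esub> T <#>\<^bsub>X\<^esub> T"

definition cone_le :: "('a, 'b) monoid_scheme \<Rightarrow> 'a set \<Rightarrow> 'a \<Rightarrow> 'a \<Rightarrow> bool" where
  "cone_le X T \<xi> \<chi> \<longleftrightarrow> \<chi> \<otimes>\<^bsub>X\<^esub> inv\<^bsub>X\<^esub> \<xi> \<in> T"

definition linearly_ordered :: "('a, 'b) monoid_scheme \<Rightarrow> 'a set \<Rightarrow> bool" where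
  "linearly_ordered X T \<longleftrightarrow> T \<union> set_inv\<^bsub>X\<^esub> T = carrier X"

definition archimedean_ordered :: "('a, 'b) monoid_scheme \<Rightarrow> 'a set \<Rightarrow> bool" where
  "archimedean_ordered X T \<longleftrightarrow>
     (\<forall>\<chi>\<in>T - {\<one>\<^bsub>X\<^esub>}. \<forall>\<xi>\<in>T - {\<one>\<^bsub>X\<^esub>}. \<exists>n::nat. cone_le X T \<chi> (\<xi> [^]\<^bsub>X\<^esub> n))"

definition characters_with_index :: "('a, 'b) monoid_scheme \<Rightarrow> 'a set \<Rightarrow> 'a set" where
  "characters_with_index X T =
     {\<chi> \<in> carrier X. \<exists>\<chi>\<^sub>1\<in>T. \<exists>\<chi>\<^sub>2\<in>T. \<chi> = \<chi>\<^sub>1 \<otimes>\<^bsub>X\<^esub> inv\<^bsub>X\<^esub> \<chi>\<^sub>2 \<and>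
        finite (T - (\<chi>\<^sub>1 <#\<^bsub>X\<^esub> T)) \<and> finite (T - (\<chi>\<^sub>2 <#\<^bsub>X\<^esub> T))}"

lemma cnj_character:
  assumes "\<chi> \<in> carrier character_group"
  shows "(\<lambda>x. cnj (\<chi> x)) \<in> carrier character_group"
    and "(\<lambda>x. cnj (\<chi> x)) \<otimes>\<^bsub>character_group\<^esub> \<chi> = \<one>\<^bsub>character_group\<^esub>"
proof -
  show "(\<lambda>x. cnj (\<chi> x)) \<in> carrier character_group"
    using assms unfolding character_group_def by (auto intro: continuous_intros)
  have "cnj (\<chi> x) * \<chi> x = 1" for x
  proof -
    have "cmod (\<chi> x) = 1" using assms unfolding character_group_def by simp
    then show ?thesis by (metis complex_norm_square mult.commute of_real_1 power_one)
  qed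
  then show "(\<lambda>x. cnj (\<chi> x)) \<otimes>\<^bsub>character_group\<^esub> \<chi> = \<one>\<^bsub>character_group\<^esub>"
    unfolding character_group_def by simp
qed

lemma comm_group_character_group: "comm_group character_group"
proof (rule comm_groupI)
  fix \<chi> \<xi> :: "'a \<Rightarrow> complex"
  assume "\<chi> \<in> carrier character_group" "\<xi> \<in> carrier character_group"
  then show "\<chi> \<otimes>\<^bsub>character_group\<^esub> \<xi> \<in> carrier character_group"
    unfolding character_group_def by (auto simp: norm_mult intro: continuous_intros)
next
  fix \<chi> :: "'a \<Rightarrow> complex"
  assume "\<chi> \<in> carrier character_group"
  then show "\<exists>\<xi>\<in>carrier character_group. \<xi> \<otimes>\<^bsub>character_group\<^esub> \<chi> = \<one>\<^bsub>character_group\<^esub>"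
    using cnj_character by blast
qed (simp_all add: character_group_def mult_ac)

lemma inv_character_group:
  assumes "\<chi> \<in> carrier character_group"
  shows "inv\<^bsub>character_group\<^esub> \<chi> = (\<lambda>x. cnj (\<chi> x))"
proof -
  interpret comm_group character_group by (rule comm_group_character_group)
  show ?thesis using cnj_character[OF assms] assms by (simp add: inv_equality)
qed

end

theory Submission
  imports Defs
begin

text \<open>
  This is a fact about ordered abelian groups, applied to the character group.  For \<open>\<chi> \<in> T\<close>
  the set \<open>T - \<chi>T\<close> is the order interval of all \<open>\<theta>\<close> with \<open>\<one> \<le> \<theta> < \<chi>\<close>.  If such an interval is finite for some \<open>\<chi> \<noteq> \<one>\<close>, then the positive
  elements cannot accumulate at \<open>\<one>\<close>, so there is a least positive element \<open>\<xi>\<close>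
  (\<open>finite_interval_imp_least_positive\<close>).  In an Archimedean order the powers of \<open>\<xi>\<close> are cofinal,
  and every positive \<open>\<eta>\<close> is trapped between two consecutive powers; the leftover quotient lies
  between \<open>\<one>\<close> and \<open>\<xi>\<close>, hence is one of these two, and \<open>\<eta>\<close> is itself a power of \<open>\<xi>\<close>
  (\<open>positive_is_power_of_least\<close>).  An ordered group has no torsion, so the group is infinite cyclic.

  Consequently, when the group is not isomorphic to the integers, the only \<open>\<chi> \<in> T\<close> with
  \<open>T - \<chi>T\<close> finite is \<open>\<one>\<close>, and the only quotient of two such elements is \<open>\<one>\<close>.
\<close>

section \<open>Infinite cyclic groups\<close>

lemma (in group) infinite_cyclic_iso_integer_group:
  assumes "x \<in> carrier G"
    and "carrier G = range (\<lambda>n::int. x [^] n)"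
    and "\<And>k::nat. x [^] Suc k \<noteq> \<one>"
  shows "G \<cong> integer_group"
proof -
  have no_collision: "x [^] m \<noteq> x [^] n" if "m < n" for m n :: int
  proof
    assume eq: "x [^] m = x [^] n"
    have "x [^] (n - m) = \<one>"
      using assms(1) eq by (simp add: int_pow_diff)
    moreover obtain k where "n - m = int (Suc k)"
      using \<open>m < n\<close> by (metis zero_less_imp_eq_int diff_gt_0_iff_gt not0_implies_Suc less_irrefl)
    ultimately show False
      using assms(3)[of k] int_pow_int[of G x "Suc k"] by metis
  qed
  have "inj (\<lambda>n::int. x [^] n)"
    by (rule linorder_injI) (rule no_collision)
  then have "(\<lambda>n::int. x [^] n) \<in> iso integer_group G"
    using hom_integer_group_pow[OF assms(1)] assms(2) by (simp add: iso_def bij_betw_def)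
  then show ?thesis
    using group.iso_sym[OF group_integer_group] is_isoI by blast
qed

section \<open>The order defined by a positive cone\<close>

context comm_group
begin

lemma positive_coneD:
  assumes "positive_cone G T"
  shows "T \<subseteq> carrier G"
    and "\<lbrakk>\<chi> \<in> T; \<xi> \<in> T\<rbrakk> \<Longrightarrow> \<chi> \<otimes> \<xi> \<in> T"
    and "\<one> \<in> T"
    and "\<lbrakk>\<chi> \<in> T; inv \<chi> \<in> T\<rbrakk> \<Longrightarrow> \<chi> = \<one>"
proof -
  show sub: "T \<subseteq> carrier G" and "\<lbrakk>\<chi> \<in> T; \<xi> \<in> T\<rbrakk> \<Longrightarrow> \<chi> \<otimes> \<xi> \<in> T" and "\<one> \<in> T"
    using assms unfolding positive_cone_def by auto
  assume \<chi>: "\<chi> \<in> T" "inv \<chi> \<in> T"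
  have "inv (inv \<chi>) \<in> set_inv T"
    using \<chi>(2) unfolding SET_INV_def by blast
  then have "\<chi> \<in> T \<inter> set_inv T"
    using \<chi>(1) sub by auto
  then show "\<chi> = \<one>"
    using assms unfolding positive_cone_def by auto
qed

lemma linearly_orderedD:
  assumes "linearly_ordered G T" "\<chi> \<in> carrier G" "\<chi> \<notin> T"
  shows "inv \<chi> \<in> T"
proof -
  have "\<chi> \<in> set_inv T"
    using assms unfolding linearly_ordered_def by blast
  then obtain \<xi> where "\<xi> \<in> T" "\<chi> = inv \<xi>"
    unfolding SET_INV_def by blast
  moreover have "\<xi> \<in> carrier G"
    using \<open>\<xi> \<in> T\<close> assms(1) unfolding linearly_ordered_def by blast
  ultimately show ?thesis by simp
qed

text \<open>
  Translates the index condition into the order: \<open>\<chi>T\<close> is the set of elements above \<open>\<chi>\<close>.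
\<close>

lemma l_coset_cone_iff:
  assumes "T \<subseteq> carrier G" "\<chi> \<in> carrier G" "\<theta> \<in> carrier G"
  shows "\<theta> \<in> \<chi> <# T \<longleftrightarrow> cone_le G T \<chi> \<theta>"
proof
  assume "\<theta> \<in> \<chi> <# T"
  then obtain \<tau> where "\<tau> \<in> T" "\<theta> = \<chi> \<otimes> \<tau>"
    unfolding l_coset_def by blast
  moreover then have "\<theta> \<otimes> inv \<chi> = \<tau>"
    using assms by (metis inv_solve_right' m_comm subsetD)
  ultimately show "cone_le G T \<chi> \<theta>"
    unfolding cone_le_def by simp
next
  assume "cone_le G T \<chi> \<theta>"
  moreover have "\<theta> = \<chi> \<otimes> (\<theta> \<otimes> inv \<chi>)"
    using assms by (metis inv_closed m_closed m_comm m_assoc l_inv r_one)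
  ultimately show "\<theta> \<in> \<chi> <# T"
    unfolding l_coset_def cone_le_def by blast
qed

lemma cone_le_trans:
  assumes "positive_cone G T" "\<chi> \<in> carrier G" "\<xi> \<in> carrier G" "\<theta> \<in> carrier G"
    and "cone_le G T \<chi> \<xi>" "cone_le G T \<xi> \<theta>"
  shows "cone_le G T \<chi> \<theta>"
proof -
  have "(\<theta> \<otimes> inv \<xi>) \<otimes> (\<xi> \<otimes> inv \<chi>) = \<theta> \<otimes> inv \<chi>"
    using assms(2-4) by (metis inv_closed m_closed m_assoc l_inv l_one)
  then show ?thesis
    using assms(5,6) positive_coneD(2)[OF assms(1)] unfolding cone_le_def by metis
qed

lemma cone_le_total:
  assumes "linearly_ordered G T" "\<chi> \<in> carrier G" "\<xi> \<in> carrier G" "\<not> cone_le G T \<chi> \<xi>"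
  shows "cone_le G T \<xi> \<chi>"
proof -
  have "inv (\<xi> \<otimes> inv \<chi>) \<in> T"
    using assms linearly_orderedD[OF assms(1)] unfolding cone_le_def by simp
  moreover have "inv (\<xi> \<otimes> inv \<chi>) = \<chi> \<otimes> inv \<xi>"
    using assms(2,3) by (simp add: inv_mult_group)
  ultimately show ?thesis
    unfolding cone_le_def by simp
qed

lemma cone_le_antisym:
  assumes "positive_cone G T" "\<chi> \<in> carrier G" "\<xi> \<in> carrier G"
    and "cone_le G T \<chi> \<xi>" "cone_le G T \<xi> \<chi>"
  shows "\<chi> = \<xi>"
proof -
  have "inv (\<xi> \<otimes> inv \<chi>) = \<chi> \<otimes> inv \<xi>"
    using assms(2,3) by (simp add: inv_mult_group)
  then have "\<xi> \<otimes> inv \<chi> = \<one>"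
    using assms(4,5) positive_coneD(4)[OF assms(1)] unfolding cone_le_def by metis
  then show ?thesis
    using assms(2,3) by (metis inv_closed inv_inv inv_equality)
qed

section \<open>Finite intervals and the least positive element\<close>

text \<open>
  The least positive element is found by minimising the number of elements of the interval
  below it: passing to a smaller positive element removes that element from the interval
  and adds nothing.
\<close>

lemma finite_interval_imp_least_positive:
  assumes cone: "positive_cone G T" and lin: "linearly_ordered G T"
    and "\<chi> \<in> T" "\<chi> \<noteq> \<one>" "finite (T - (\<chi> <# T))"
  obtains \<xi> where "\<xi> \<in> T" "\<xi> \<noteq> \<one>" "\<And>\<theta>. \<lbrakk>\<theta> \<in> T; \<theta> \<noteq> \<one>\<rbrakk> \<Longrightarrow> cone_le G T \<xi> \<theta>"
proof -
  note T = positive_coneD[OF cone]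
  define P where "P \<xi> \<longleftrightarrow> \<xi> \<in> T \<and> \<xi> \<noteq> \<one> \<and> finite (T - (\<xi> <# T))" for \<xi>
  define size_below where "size_below \<xi> = card (T - (\<xi> <# T))" for \<xi>
  have "P \<chi>"
    using assms by (simp add: P_def)
  then obtain \<xi> where \<xi>: "P \<xi>" and minimal: "\<And>\<theta>. P \<theta> \<Longrightarrow> size_below \<xi> \<le> size_below \<theta>"
    by (metis ex_has_least_nat)
  have "cone_le G T \<xi> \<theta>" if \<theta>: "\<theta> \<in> T" "\<theta> \<noteq> \<one>" for \<theta>
  proof (rule ccontr)
    assume not_le: "\<not> cone_le G T \<xi> \<theta>"
    have car: "\<xi> \<in> carrier G" "\<theta> \<in> carrier G"
      using \<xi> \<theta> T(1) by (auto simp: P_def)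
    have le: "cone_le G T \<theta> \<xi>"
      using cone_le_total[OF lin car not_le] .
    have "T - (\<theta> <# T) \<subseteq> T - (\<xi> <# T)"
    proof
      fix \<eta> assume \<eta>: "\<eta> \<in> T - (\<theta> <# T)"
      then have "\<eta> \<in> carrier G" "\<not> cone_le G T \<theta> \<eta>"
        using T(1) car l_coset_cone_iff by auto
      then have "\<not> cone_le G T \<xi> \<eta>"
        using cone_le_trans[OF cone car(2) car(1) _ le] by blast
      then show "\<eta> \<in> T - (\<xi> <# T)"
        using \<eta> \<open>\<eta> \<in> carrier G\<close> T(1) car l_coset_cone_iff by auto
    qed
    moreover have "\<theta> \<in> T - (\<xi> <# T)" "\<theta> \<notin> T - (\<theta> <# T)"
      using \<theta> not_le T(1,3) car by (auto simp: l_coset_cone_iff) (simp add: cone_le_def)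
    ultimately have "T - (\<theta> <# T) \<subset> T - (\<xi> <# T)"
      by blast
    moreover have "finite (T - (\<xi> <# T))"
      using \<xi> by (simp add: P_def)
    ultimately have "P \<theta>" "size_below \<theta> < size_below \<xi>"
      using \<theta> finite_subset by (auto simp: P_def size_below_def intro: psubset_card_mono)
    then show False
      using minimal by fastforce
  qed
  then show ?thesis
    using that \<xi> by (auto simp: P_def)
qed

text \<open>
  Division with remainder by the least positive element: the remainder can only be \<open>\<one>\<close> or \<open>\<xi>\<close>.
\<close>

lemma positive_is_power_of_least:
  assumes cone: "positive_cone G T" and lin: "linearly_ordered G T"
    and arch: "archimedean_ordered G T"
    and \<xi>: "\<xi> \<in> T" "\<xi> \<noteq> \<one>" and least: "\<And>\<theta>. \<lbrakk>\<theta> \<in> T; \<theta> \<noteq> \<one>\<rbrakk> \<Longrightarrow> cone_le G T \<xi> \<theta>"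
    and \<eta>: "\<eta> \<in> T"
  shows "\<exists>n::nat. \<eta> = \<xi> [^] n"
proof (cases "\<eta> = \<one>")
  case True
  then have "\<eta> = \<xi> [^] (0::nat)" by simp
  then show ?thesis by blast
next
  case False
  note T = positive_coneD[OF cone]
  have car: "\<xi> \<in> carrier G" "\<eta> \<in> carrier G"
    using \<xi> \<eta> T(1) by auto
  have bounded: "\<exists>n::nat. cone_le G T \<eta> (\<xi> [^] n)"
    using arch \<xi> \<eta> False unfolding archimedean_ordered_def by blast
  define n where "n = (LEAST n::nat. cone_le G T \<eta> (\<xi> [^] n))"
  have upper: "cone_le G T \<eta> (\<xi> [^] n)"
    unfolding n_def using bounded by (rule LeastI_ex)
  \<comment> \<open>The exponent cannot be \<open>0\<close>, since \<open>\<eta>\<close> lies strictly above \<open>\<one>\<close>.\<close>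
  have "n \<noteq> 0"
  proof
    assume "n = 0"
    then have "inv \<eta> \<in> T"
      using upper car by (simp add: cone_le_def)
    then show False
      using T(4) \<eta> False by blast
  qed
  then obtain m where n: "n = Suc m"
    using not0_implies_Suc by blast
  have "\<not> cone_le G T \<eta> (\<xi> [^] m)"
    using not_less_Least[of m "\<lambda>n. cone_le G T \<eta> (\<xi> [^] n)"] n by (simp add: n_def)
  then have lower: "\<eta> \<otimes> inv (\<xi> [^] m) \<in> T"
    using cone_le_total[OF lin] car by (simp add: cone_le_def)
  define \<rho> where "\<rho> = \<eta> \<otimes> inv (\<xi> [^] m)"
  have \<rho>: "\<rho> \<in> T" "\<rho> \<in> carrier G"
    using lower car by (simp_all add: \<rho>_def)
  have \<eta>_eq: "\<eta> = \<rho> \<otimes> \<xi> [^] m"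
    using car by (simp add: \<rho>_def m_assoc)
  have "\<xi> \<otimes> inv \<rho> = \<xi> [^] n \<otimes> inv \<eta>"
  proof -
    have "\<xi> \<otimes> inv \<rho> = \<xi> \<otimes> (\<xi> [^] m \<otimes> inv \<eta>)"
      using car by (simp add: \<rho>_def inv_mult_group)
    also have "\<dots> = (\<xi> \<otimes> \<xi> [^] m) \<otimes> inv \<eta>"
      using car by (simp add: m_assoc)
    also have "\<dots> = \<xi> [^] n \<otimes> inv \<eta>"
      using car n by (simp add: m_comm)
    finally show ?thesis .
  qed
  then have "cone_le G T \<rho> \<xi>"
    using upper by (simp add: cone_le_def)
  then have "\<rho> = \<one> \<or> \<rho> = \<xi>"
    using least[OF \<rho>(1)] cone_le_antisym[OF cone car(1) \<rho>(2)] by blast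
  then have "\<eta> = \<xi> [^] m \<or> \<eta> = \<xi> [^] Suc m"
    using \<eta>_eq car by (auto simp: m_comm)
  then show ?thesis by blast
qed

text \<open>
  If \<open>\<xi>\<^sup>k\<^sup>+\<^sup>1 = \<one>\<close>, then \<open>inv \<xi> = \<xi>\<^sup>k\<close> is positive along with \<open>\<xi>\<close>.
\<close>

lemma positive_power_ne_one:
  assumes cone: "positive_cone G T" and \<xi>: "\<xi> \<in> T" "\<xi> \<noteq> \<one>"
  shows "\<xi> [^] Suc k \<noteq> \<one>"
proof
  note T = positive_coneD[OF cone]
  have pow: "\<xi> [^] k \<in> T" for k :: nat
    by (induction k) (simp_all add: T(2,3) \<xi>(1))
  assume "\<xi> [^] Suc k = \<one>"
  then have "inv \<xi> = \<xi> [^] k"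
    using \<xi>(1) T(1) by (intro inv_equality) auto
  then show False
    using pow[of k] \<xi> T(4) by simp
qed

lemma finite_interval_imp_iso_integer_group:
  assumes cone: "positive_cone G T" and lin: "linearly_ordered G T"
    and arch: "archimedean_ordered G T"
    and "\<chi> \<in> T" "\<chi> \<noteq> \<one>" "finite (T - (\<chi> <# T))"
  shows "G \<cong> integer_group"
proof -
  note T = positive_coneD[OF cone]
  obtain \<xi> where \<xi>: "\<xi> \<in> T" "\<xi> \<noteq> \<one>"
    and least: "\<And>\<theta>. \<lbrakk>\<theta> \<in> T; \<theta> \<noteq> \<one>\<rbrakk> \<Longrightarrow> cone_le G T \<xi> \<theta>"
    using finite_interval_imp_least_positive[OF cone lin assms(4-6)] by blast
  have car: "\<xi> \<in> carrier G"
    using \<xi> T(1) by blast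
  have pos: "\<eta> \<in> range (\<lambda>n::int. \<xi> [^] n) \<and> inv \<eta> \<in> range (\<lambda>n::int. \<xi> [^] n)" if \<eta>: "\<eta> \<in> T" for \<eta>
  proof -
    obtain n :: nat where "\<eta> = \<xi> [^] n"
      using positive_is_power_of_least[OF cone lin arch \<xi> least \<eta>] by blast
    then have "\<eta> = \<xi> [^] int n" "inv \<eta> = \<xi> [^] (- int n)"
      using car by (simp_all add: int_pow_int int_pow_neg)
    then show ?thesis by blast
  qed
  have "\<eta> \<in> range (\<lambda>n::int. \<xi> [^] n)" if "\<eta> \<in> carrier G" for \<eta>
  proof (cases "\<eta> \<in> T")
    case True
    then show ?thesis using pos by blast
  next
    case False
    then show ?thesis using pos[OF linearly_orderedD[OF lin that]] that by simp
  qed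
  then have "carrier G = range (\<lambda>n::int. \<xi> [^] n)"
    using car by auto
  then show ?thesis
    using infinite_cyclic_iso_integer_group[OF car] positive_power_ne_one[OF cone \<xi>] by blast
qed

section \<open>Characters with an index\<close>

theorem characters_with_index_trivial:
  assumes cone: "positive_cone G T" and lin: "linearly_ordered G T"
    and arch: "archimedean_ordered G T"
    and "\<not> G \<cong> integer_group"
  shows "characters_with_index G T = {\<one>}"
proof -
  note T = positive_coneD[OF cone]
  have only_one: "\<chi> = \<one>" if "\<chi> \<in> T" "finite (T - (\<chi> <# T))" for \<chi>
    using finite_interval_imp_iso_integer_group[OF cone lin arch] that assms(4) by blast
  have "\<one> <# T = T"
    using T(1) by (rule lcos_mult_one)
  then have "\<one> \<in> characters_with_index G T"
    using T(3) unfolding characters_with_index_def by (auto intro!: bexI[of _ "\<one>"])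
  moreover have "characters_with_index G T \<subseteq> {\<one>}"
  proof
    fix \<chi> assume "\<chi> \<in> characters_with_index G T"
    then obtain \<chi>\<^sub>1 \<chi>\<^sub>2 where "\<chi> = \<chi>\<^sub>1 \<otimes> inv \<chi>\<^sub>2" "\<chi>\<^sub>1 = \<one>" "\<chi>\<^sub>2 = \<one>"
      unfolding characters_with_index_def using only_one by blast
    then show "\<chi> \<in> {\<one>}" by simp
  qed
  ultimately show ?thesis by blast
qed

end

theorem corollary3:
  fixes T :: "('g::{topological_ab_group_add, t2_space} \<Rightarrow> complex) set"
  assumes "compact (UNIV :: 'g set)"
    and "connected (UNIV :: 'g set)"
    and "(UNIV :: 'g set) \<noteq> {0}"
    and "positive_cone character_group T"
    and "\<not> (character_group :: ('g \<Rightarrow> complex) monoid) \<cong> integer_group"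
    and "linearly_ordered character_group T"
    and "archimedean_ordered character_group T"
  shows "characters_with_index character_group T = {\<one>\<^bsub>character_group\<^esub>}"
  using comm_group.characters_with_index_trivial[OF comm_group_character_group
      assms(4,6,7,5)] .

end
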